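(* Let $\omega\in\mathcal{W}_0$ be given and let $\mathcal{M}_\omega=\{W^{(l)}:l>0\}$ be the associated weight matrix, with quotients $\vartheta^{(l)}$. Then all of the following assertions hold for $\mathcal{M}_\omega$ (with $x,y$ ranging over $\mathbb{R}_{>0}$). Roumieu type: - $(I_R)$ $\forall x\,\exists C>0\,\exists y\,\forall p,q\in\mathbb{N}:\ W^{(x)}_{p+q}\le C^{p+q}W^{(y)}_pW^{(y)}_q$; - $(II_R)$ $\forall x\,\exists C>0\,\exists y\,\forall p\in\mathbb{N}:\ W^{(x)}_{2p}\le C^{2p}(W^{(y)}_p)^2$; - $(III_R)$ $\forall x\,\exists H\ge1\,\exists y\,\forall t\ge0:\ 2\omega_{W^{(y)}}(t)\le\omega_{W^{(x)}}(Ht)+H$; - $(IV_R)$ $\forall x\,\exists A\ge1\,\exists y\,\forall p\in\mathbb{N}:\ \vartheta^{(x)}_{2p}\le A\vartheta^{(y)}_p$; - $(V_R)$ $\forall x\,\exists A\ge1\,\exists y\,\forall t\ge0:\ 2\Sigma_{W^{(y)}}(t)\le\Sigma_{W^{(x)}}(At)$. Beurling type: - $(I_B)$ $\forall x\,\exists C>0\,\exists y\,\forall p,q\in\mathbb{N}:\ W^{(y)}_{p+q}\le C^{p+q}W^{(x)}_pW^{(x)}_q$; - $(II_B)$ $\forall y\,\exists C>0\,\exists x\,\forall p\in\mathbb{N}:\ W^{(x)}_{2p}\le C^{2p}(W^{(y)}_p)^2$; - $(III_B)$ $\forall x\,\exists H\ge1\,\exists y\,\forall t\ge0:\ 2\omega_{W^{(x)}}(t)\le\omega_{W^{(y)}}(Ht)+H$;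 - $(IV_B)$ $\forall x\,\exists A\ge1\,\exists y\,\forall p\in\mathbb{N}:\ \vartheta^{(y)}_{2p}\le A\vartheta^{(x)}_p$; - $(V_B)$ $\forall x\,\exists A\ge1\,\exists y\,\forall t\ge0:\ 2\Sigma_{W^{(x)}}(t)\le\Sigma_{W^{(y)}}(At)$.
   Context: $\mathbb{N}=\{0,1,2,\dots\}$, $\mathbb{N}_{>0}=\{1,2,\dots\}$. $\mathcal{W}_0$ is the set of functions $\omega:[0,+\infty)\to[0,+\infty)$ that are continuous, nondecreasing, satisfy $\omega(t)=0$ for $t\in[0,1]$ and $\lim_{t\to+\infty}\omega(t)=+\infty$, $\log t=o(\omega(t))$ as $t\to+\infty$, and such that $\varphi_\omega:t\mapsto\omega(e^t)$ is convex on $\mathbb{R}$. For $\omega\in\mathcal{W}_0$ put $\varphi^*_\omega(x):=\sup\{xy-\varphi_\omega(y):y\ge0\}$ for $x\ge 0$. The associated weight matrix is $\mathcal{M}_\omega:=\{W^{(l)}:l>0\}$ with $W^{(l)}_p:=\exp\big(\tfrac1l\varphi^*_\omega(lp)\big)$, $p\in\mathbb{N}$; put $\vartheta^{(l)}_p:=W^{(l)}_p/W^{(l)}_{p-1}$ for $p\ge 1$, $\vartheta^{(l)}_0:=1$. For a sequence $M=(M_p)_p$ of positive reals with $M_0=1$ and $(M_p)^{1/p}\to+\infty$: $\omega_M(t):=\sup_{p\in\mathbb{N}}\log(t^p/M_p)$ for $t>0$, $\omega_M(0):=0$; and $\Sigma_M(t):=|\{p\in\mathbb{N}_{>0}: M_p/M_{p-1}\le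 t\}|$. *)

theory Defs
  imports "HOL-Analysis.Analysis" "HOL-Library.Landau_Symbols"
begin

(* A weight function on [0, \<infinity>) is represented by a total function on the reals;
   only its values on {0..} are constrained or used. *)
definition weight_functions :: "(real \<Rightarrow> real) set" ("\<W>\<^sub>0")
  where "\<W>\<^sub>0 = {\<omega>. \<omega> \<in> {0..} \<rightarrow> {0..} \<and> continuous_on {0..} \<omega> \<and> mono_on {0..} \<omega>
           \<and> (\<forall>t\<in>{0..1}. \<omega> t = 0) \<and> filterlim \<omega> at_top at_top
           \<and> (\<lambda>t. ln t) \<in> o[at_top](\<omega>) \<and> convex_on UNIV (\<lambda>t. \<omega> (exp t))}"

(* Meant for x \<ge> 0; the supremum is finite for \<omega> in \<W>\<^sub>0 because log t = o(\<omega>(t)). *)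
definition young_conj :: "(real \<Rightarrow> real) \<Rightarrow> real \<Rightarrow> real"
  where "young_conj \<omega> x = Sup {x * y - \<omega> (exp y) | y. y \<ge> 0}"

(* The sequence W^(l), to be used for l > 0. *)
definition weight_seq :: "(real \<Rightarrow> real) \<Rightarrow> real \<Rightarrow> nat \<Rightarrow> real"
  where "weight_seq \<omega> l p = exp (1 / l * young_conj \<omega> (l * real p))"

definition weight_quot :: "(real \<Rightarrow> real) \<Rightarrow> real \<Rightarrow> nat \<Rightarrow> real"
  where "weight_quot \<omega> l p =
    (if p = 0 then 1 else weight_seq \<omega> l p / weight_seq \<omega> l (p - 1))"

(* Both notions below are meant for positive sequences M with M 0 = 1 and (M p)^(1/p) \<rightarrow> \<infinity>;
   then the supremum is finite. *)
definition assoc_weight :: "(nat \<Rightarrow> real) \<Rightarrow> real \<Rightarrow> real"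
  where "assoc_weight M t = (if t = 0 then 0 else (SUP p. ln (t ^ p / M p)))"

(* The set is finite when the quotients M p / M (p - 1) tend to infinity, in particular
   for M = weight_seq \<omega> l with \<omega> in \<W>\<^sub>0 and l > 0, so that card is the genuine cardinality. *)
definition counting_fun :: "(nat \<Rightarrow> real) \<Rightarrow> real \<Rightarrow> nat"
  where "counting_fun M t = card {p. p > 0 \<and> M p / M (p - 1) \<le> t}"

end

theory Submission
  imports Defs
begin

text \<open>Write \<open>g\<close> for the Young conjugate. It is convex with \<open>g 0 = 0\<close>, and
  \<open>ln (\<theta> l p)\<close> is the slope of the chord of \<open>g\<close> over \<open>[l (p - 1), l p]\<close>. Midpoint convexity
  gives \<open>g (l (p + q)) \<le> (g (2 l p) + g (2 l q)) / 2\<close>, that is (I) and (II) with \<open>C = 1\<close> and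
  indices \<open>l\<close>, \<open>2 l\<close>; passing to suprema yields (III). For (IV) take the indices \<open>l\<close>, \<open>4 l\<close>:
  for \<open>p \<ge> 2\<close> the interval \<open>[4 l (p - 1), 4 l p]\<close> lies to the right of \<open>[l (2 p - 1), 2 l p]\<close>,
  and chord slopes of a convex function increase; the case \<open>p = 1\<close> is absorbed by \<open>A\<close>. Finally (V) restates (IV) in terms of the
  counting functions of the increasing quotients. The Roumieu and Beurling types differ only in
  which of the two indices is prescribed.\<close>

section \<open>Chord slopes of convex functions\<close>

lemma convex_on_chord_slope_mono:
  fixes f :: "real \<Rightarrow> real"
  assumes f: "convex_on S f" and S: "a \<in> S" "d \<in> S" "b \<in> S" "c \<in> S"
    and "a < b" "c < d" "a \<le> c" "b \<le> d"
  shows "(f b - f a) / (b - a) \<le> (f d - f c) / (d - c)"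
proof -
  have swap: "(f u - f v) / (u - v) = (f v - f u) / (v - u)" for u v
    by (metis minus_diff_eq minus_divide_divide)
  \<comment> \<open>One endpoint moves at a time: first \<open>b\<close> to \<open>d\<close>, then
    \<open>a\<close> to \<open>c\<close>; neither move lowers the slope.\<close>
  have "(f b - f a) / (b - a) \<le> (f d - f a) / (d - a)"
  proof (cases "b = d")
    case False
    then show ?thesis
      using convex_on_slope_le(1)[OF f, of a d b] assms by (simp add: swap[of a])
  qed simp
  also have "\<dots> \<le> (f d - f c) / (d - c)"
  proof (cases "a = c")
    case False
    then show ?thesis
      using convex_on_slope_le(2)[OF f, of a d c] assms by (simp add: swap[of _ d])
  qed simp
  finally show ?thesis .
qed

section \<open>The Young conjugate\<close>

lemma weight_nonneg: "\<omega> \<in> \<W>\<^sub>0 \<Longrightarrow> 0 \<le> t \<Longrightarrow> 0 \<le> \<omega> t"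
  by (auto simp: weight_functions_def)

text \<open>Since \<open>ln t\<close> is \<open>o(\<omega> t)\<close>, the weight
  \<open>\<omega> (exp y)\<close> eventually outgrows every multiple of \<open>y\<close>, so only a
  bounded range of \<open>y\<close> can give positive terms.\<close>

lemma bdd_above_young_conj:
  assumes "\<omega> \<in> \<W>\<^sub>0"
  shows "bdd_above {s * y - \<omega> (exp y) | y. y \<ge> 0}"
proof -
  \<comment> \<open>With this \<open>c\<close>, the little-o bound at \<open>t = exp y\<close> reads
    \<open>(\<bar>s\<bar> + 1) * y \<le> \<omega> (exp y)\<close>.\<close>
  define c where "c = 1 / (\<bar>s\<bar> + 1)"
  have "c > 0" by (simp add: c_def add_nonneg_pos)
  moreover have "(\<lambda>t. ln t) \<in> o[at_top](\<omega>)"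
    using assms by (simp add: weight_functions_def)
  ultimately have "eventually (\<lambda>t. norm (ln t) \<le> c * norm (\<omega> t)) at_top"
    by (rule landau_o.smallD[rotated])
  then obtain T where T: "\<And>t. t \<ge> T \<Longrightarrow> \<bar>ln t\<bar> \<le> c * \<bar>\<omega> t\<bar>"
    by (auto simp: eventually_at_top_linorder)
  have "s * y - \<omega> (exp y) \<le> \<bar>s\<bar> * \<bar>T\<bar>" if "y \<ge> 0" for y
  proof (cases "exp y \<ge> T")
    case True
    have "\<omega> (exp y) \<ge> 0" using weight_nonneg[OF assms] by simp
    with T[OF True] that have "y \<le> \<omega> (exp y) / (\<bar>s\<bar> + 1)" by (simp add: c_def)
    then have "(\<bar>s\<bar> + 1) * y \<le> \<omega> (exp y)"
      by (simp add: pos_le_divide_eq add_nonneg_pos mult.commute)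
    moreover have "s * y \<le> (\<bar>s\<bar> + 1) * y" using that by (intro mult_right_mono) auto
    moreover have "0 \<le> \<bar>s\<bar> * \<bar>T\<bar>" by simp
    ultimately show ?thesis by linarith
  next
    case False
    then have "y \<le> \<bar>T\<bar>" using exp_ge_add_one_self[of y] by linarith
    then have "s * y \<le> \<bar>s\<bar> * \<bar>T\<bar>" using that by (intro mult_mono) auto
    moreover have "\<omega> (exp y) \<ge> 0" using weight_nonneg[OF assms] by simp
    ultimately show ?thesis by linarith
  qed
  then show ?thesis by (intro bdd_aboveI) auto
qed

lemma young_conj_ge:
  assumes "\<omega> \<in> \<W>\<^sub>0" "y \<ge> 0"
  shows "s * y - \<omega> (exp y) \<le> young_conj \<omega> s"
  unfolding young_conj_def using assms by (intro cSup_upper bdd_above_young_conj) auto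

lemma young_conj_le:
  assumes "\<And>y. y \<ge> 0 \<Longrightarrow> s * y - \<omega> (exp y) \<le> B"
  shows "young_conj \<omega> s \<le> B"
  unfolding young_conj_def by (rule cSup_least) (use assms in auto)

text \<open>The term at \<open>y = 0\<close> vanishes because \<open>\<omega> 1 = 0\<close>.\<close>

lemma young_conj_nonneg: "\<omega> \<in> \<W>\<^sub>0 \<Longrightarrow> 0 \<le> young_conj \<omega> s"
  using young_conj_ge[of \<omega> 0 s] by (simp add: weight_functions_def)

lemma young_conj_0: "\<omega> \<in> \<W>\<^sub>0 \<Longrightarrow> young_conj \<omega> 0 = 0"
  by (intro antisym young_conj_nonneg young_conj_le) (auto simp: weight_nonneg)

text \<open>A pointwise supremum of functions affine in the argument is convex.\<close>

lemma convex_on_young_conj: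
  assumes "\<omega> \<in> \<W>\<^sub>0"
  shows "convex_on UNIV (young_conj \<omega>)"
proof (rule convex_onI)
  fix t a b :: real
  assume t: "0 < t" "t < 1"
  show "young_conj \<omega> ((1 - t) *\<^sub>R a + t *\<^sub>R b) \<le> (1 - t) * young_conj \<omega> a + t * young_conj \<omega> b"
  proof (rule young_conj_le)
    fix y :: real
    assume "y \<ge> 0"
    then have "(1 - t) * (a * y - \<omega> (exp y)) + t * (b * y - \<omega> (exp y))
        \<le> (1 - t) * young_conj \<omega> a + t * young_conj \<omega> b"
      using t by (intro add_mono mult_left_mono young_conj_ge[OF assms]) auto
    then show "((1 - t) *\<^sub>R a + t *\<^sub>R b) * y - \<omega> (exp y)
        \<le> (1 - t) * young_conj \<omega> a + t * young_conj \<omega> b"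
      by (simp add: algebra_simps)
  qed
qed simp

section \<open>Weight sequences and associated weight functions\<close>

lemma weight_seq_pos: "0 < weight_seq \<omega> l p"
  by (simp add: weight_seq_def)

lemma weight_seq_add_le:
  assumes "\<omega> \<in> \<W>\<^sub>0" "l > 0"
  shows "weight_seq \<omega> l (p + q) \<le> weight_seq \<omega> (2 * l) p * weight_seq \<omega> (2 * l) q"
proof -
  have "young_conj \<omega> (l * real (p + q))
      \<le> (young_conj \<omega> (2 * l * p) + young_conj \<omega> (2 * l * q)) / 2"
    using convex_onD[OF convex_on_young_conj[OF assms(1)], of "1/2" "2 * l * p" "2 * l * q"]
    by (simp add: algebra_simps)
  \<comment> \<open>Dividing by \<open>l\<close> turns the midpoint factor 1/2 into the
    \<open>1 / (2 * l)\<close> of the new index, so no constant is lost.\<close>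
  then show ?thesis
    using assms(2) by (simp add: weight_seq_def exp_add[symmetric] field_simps)
qed

text \<open>A real supremum dominates its terms only if they are bounded above; here
  \<open>\<omega> (exp y) / l\<close> is a bound independent of \<open>p\<close>.\<close>

lemma assoc_weight_ge:
  assumes "\<omega> \<in> \<W>\<^sub>0" "l > 0" "t > 0"
  shows "ln (t ^ p / weight_seq \<omega> l p) \<le> assoc_weight (weight_seq \<omega> l) t"
proof -
  \<comment> \<open>The conjugate admits only \<open>y \<ge> 0\<close>, so \<open>ln t\<close> is
    truncated at 0, which can only increase \<open>p * ln t\<close>.\<close>
  define y where "y = max 0 (ln t)"
  have "ln (t ^ p / weight_seq \<omega> l p) \<le> \<omega> (exp y) / l" for p
  proof -
    have "p * ln t \<le> p * y"
      by (rule mult_left_mono) (auto simp: y_def)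
    moreover have "p * y - \<omega> (exp y) / l \<le> young_conj \<omega> (l * p) / l"
      using divide_right_mono[OF young_conj_ge[OF assms(1), of y "l * p"], of l] assms(2)
      by (simp add: y_def diff_divide_distrib)
    ultimately show ?thesis
      using assms by (simp add: weight_seq_def ln_div ln_realpow)
  qed
  then have "bdd_above (range (\<lambda>p. ln (t ^ p / weight_seq \<omega> l p)))"
    by (intro bdd_aboveI) auto
  then show ?thesis
    using assms(3) by (auto simp: assoc_weight_def intro: cSUP_upper)
qed

text \<open>Twice the \<open>p\<close>-th term for \<open>2 * l\<close> is at most the term of index
  \<open>2 * p\<close> for \<open>l\<close>, by \<open>weight_seq_add_le\<close> with
  \<open>q = p\<close>.\<close>

lemma double_assoc_weight_le:
  assumes "\<omega> \<in> \<W>\<^sub>0" "l > 0" "t \<ge> 0"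
  shows "2 * assoc_weight (weight_seq \<omega> (2 * l)) t \<le> assoc_weight (weight_seq \<omega> l) t"
proof (cases "t = 0")
  case True
  then show ?thesis by (simp add: assoc_weight_def)
next
  case False
  have "2 * ln (t ^ p / weight_seq \<omega> (2 * l) p) \<le> assoc_weight (weight_seq \<omega> l) t" for p
  proof -
    have "2 * ln (t ^ p / weight_seq \<omega> (2 * l) p) = ln ((t ^ p / weight_seq \<omega> (2 * l) p)\<^sup>2)"
      by (subst ln_realpow) (use False assms weight_seq_pos in auto)
    also have "\<dots> \<le> ln (t ^ (p + p) / weight_seq \<omega> l (p + p))"
      using False assms weight_seq_add_le[OF assms(1,2), of p p] weight_seq_pos[of \<omega>]
      by (subst ln_le_cancel_iff)
        (auto simp: power_add power2_eq_square intro!: divide_left_mono divide_pos_pos)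
    also have "\<dots> \<le> assoc_weight (weight_seq \<omega> l) t"
      using False assms by (intro assoc_weight_ge) auto
    finally show ?thesis .
  qed
  then have "(SUP p. ln (t ^ p / weight_seq \<omega> (2 * l) p)) \<le> assoc_weight (weight_seq \<omega> l) t / 2"
    by (intro cSUP_least) (auto simp: field_simps)
  then show ?thesis
    using False by (simp add: assoc_weight_def)
qed

section \<open>Quotients as chord slopes\<close>

lemma weight_quot_pos: "0 < weight_quot \<omega> l p"
  by (simp add: weight_quot_def weight_seq_pos)

text \<open>The denominator equals \<open>l\<close>; it stays unsimplified to match
  \<open>convex_on_chord_slope_mono\<close>.\<close>

lemma weight_quot_Suc:
  assumes "l > 0"
  shows "weight_quot \<omega> l (Suc p) =
    exp ((young_conj \<omega> (l * Suc p) - young_conj \<omega> (l * p)) / (l * Suc p - l * p))"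
  using assms by (simp add: weight_quot_def weight_seq_def exp_diff[symmetric] field_simps)

lemma weight_quot_mono:
  assumes "\<omega> \<in> \<W>\<^sub>0" "l > 0" "1 \<le> p" "p \<le> q"
  shows "weight_quot \<omega> l p \<le> weight_quot \<omega> l q"
proof -
  obtain p' q' where "p = Suc p'" "q = Suc q'" "p' \<le> q'"
    using assms(3,4) by (cases p; cases q) auto
  then show ?thesis
    using assms(2) unfolding weight_quot_Suc[OF assms(2)] \<open>p = Suc p'\<close> \<open>q = Suc q'\<close> exp_le_cancel_iff
    by (intro convex_on_chord_slope_mono[OF convex_on_young_conj[OF assms(1)]]) auto
qed

lemma weight_quot_double_le:
  assumes "\<omega> \<in> \<W>\<^sub>0" "l > 0"
  shows "weight_quot \<omega> l (2 * p) \<le> max 1 (weight_quot \<omega> l 2) * weight_quot \<omega> (4 * l) p"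
proof -
  consider "p = 0" | "p = 1" | k where "p = Suc (Suc k)"
    by (metis One_nat_def not0_implies_Suc)
  then show ?thesis
  proof cases
    case 1
    then show ?thesis by (simp add: weight_quot_def)
  next
    case 2
    \<comment> \<open>The chord for \<open>4 * l\<close> now starts at 0, so slopes cannot be
      compared as for \<open>p \<ge> 2\<close>. Its slope is nonnegative, however, and the prefactor
      covers \<open>weight_quot \<omega> l 2\<close>.\<close>
    have "1 \<le> weight_quot \<omega> (4 * l) (Suc 0)"
      using assms young_conj_nonneg[OF assms(1)] young_conj_0[OF assms(1)]
      by (subst weight_quot_Suc) auto
    then have "max 1 (weight_quot \<omega> l 2) * 1 \<le> max 1 (weight_quot \<omega> l 2) * weight_quot \<omega> (4 * l) 1"
      by (intro mult_left_mono) auto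
    with 2 show ?thesis by simp
  next
    case 3
    \<comment> \<open>In units of \<open>l\<close>, the endpoints satisfy
      \<open>2 * k + 3 \<le> 4 * (k + 1)\<close> and \<open>2 * k + 4 \<le> 4 * (k + 2)\<close>.
      With \<open>2 * l\<close> in place of \<open>4 * l\<close> the left endpoints would be in the
      wrong order.\<close>
    have "weight_quot \<omega> l (Suc (2 * k + 3)) \<le> weight_quot \<omega> (4 * l) (Suc (Suc k))"
    proof -
      have "4 * l > 0" using assms(2) by simp
      show ?thesis
        unfolding weight_quot_Suc[OF assms(2)] weight_quot_Suc[OF \<open>4 * l > 0\<close>] exp_le_cancel_iff
        using assms(2)
        by (intro convex_on_chord_slope_mono[OF convex_on_young_conj[OF assms(1)]])
          (auto simp: algebra_simps)
    qed
    also have "\<dots> \<le> max 1 (weight_quot \<omega> l 2) * weight_quot \<omega> (4 * l) (Suc (Suc k))"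
      using mult_right_mono[of 1 "max 1 (weight_quot \<omega> l 2)"] weight_quot_pos[THEN less_imp_le]
      by simp
    finally show ?thesis using 3 by (simp add: numeral_eq_Suc)
  qed
qed

text \<open>A last slope of at most \<open>ln t\<close> forces the conjugate below the line of slope
  \<open>ln t\<close>, but it grows faster than any line. Finiteness keeps \<open>card\<close> away
  from its default 0 on infinite sets.\<close>

lemma finite_weight_quot_le:
  assumes "\<omega> \<in> \<W>\<^sub>0" "l > 0"
  shows "finite {p. p > 0 \<and> weight_quot \<omega> l p \<le> t}"
proof -
  \<comment> \<open>Any \<open>y \<ge> 0\<close> strictly above \<open>ln t\<close> works: the gap
    \<open>y - ln t\<close> becomes the divisor that bounds \<open>p\<close>.\<close>
  define y where "y = max 0 (ln t) + 1"
  have y: "y > 0" "ln t < y" by (auto simp: y_def)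
  have "real p \<le> \<omega> (exp y) / (l * (y - ln t))" if "p > 0" "weight_quot \<omega> l p \<le> t" for p
  proof -
    from \<open>p > 0\<close> obtain k where k: "p = Suc k" by (cases p) auto
    \<comment> \<open>The chord over \<open>[0, l * p]\<close> is compared with the last one, over
      \<open>[l * k, l * p]\<close>.\<close>
    have "young_conj \<omega> (l * p) / (l * p)
        \<le> (young_conj \<omega> (l * Suc k) - young_conj \<omega> (l * k)) / (l * Suc k - l * k)"
      using convex_on_chord_slope_mono[OF convex_on_young_conj[OF assms(1)],
          of 0 "l * Suc k" "l * Suc k" "l * k"] assms(2) young_conj_0[OF assms(1)]
      by (auto simp: k)
    also have "\<dots> = ln (weight_quot \<omega> l p)"
      unfolding k weight_quot_Suc[OF assms(2)] by simp
    also have "\<dots> \<le> ln t"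
      using that weight_quot_pos[of \<omega>] by (intro ln_mono)
    finally have "young_conj \<omega> (l * p) \<le> ln t * (l * p)"
      using assms(2) that(1) by (simp add: pos_divide_le_eq)
    moreover have "l * p * y - \<omega> (exp y) \<le> young_conj \<omega> (l * p)"
      using y by (intro young_conj_ge assms) auto
    ultimately have "real p * (l * (y - ln t)) \<le> \<omega> (exp y)"
      by (simp add: algebra_simps)
    then show ?thesis
      using assms(2) y by (simp add: pos_le_divide_eq)
  qed
  then have "{p. p > 0 \<and> weight_quot \<omega> l p \<le> t} \<subseteq> {..nat \<lfloor>\<omega> (exp y) / (l * (y - ln t))\<rfloor>}"
    by (auto simp: le_nat_floor)
  then show ?thesis by (rule finite_subset) simp
qed

section \<open>Counting functions\<close>

lemma counting_fun_weight_seq: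
  "counting_fun (weight_seq \<omega> l) t = card {p. p > 0 \<and> weight_quot \<omega> l p \<le> t}"
  unfolding counting_fun_def by (rule arg_cong[where f = card]) (auto simp: weight_quot_def)

text \<open>If \<open>n\<close> is the last index counted for \<open>l'\<close> at \<open>t\<close>,
  then \<open>quot\<close> and monotonicity of the quotients put all of \<open>1, ..., 2 * n\<close>
  into the count for \<open>l\<close> at \<open>A * t\<close>.\<close>

lemma double_counting_fun_le:
  assumes "\<omega> \<in> \<W>\<^sub>0" "l > 0" "l' > 0" "A \<ge> 0"
    and quot: "\<And>p. weight_quot \<omega> l (2 * p) \<le> A * weight_quot \<omega> l' p"
  shows "2 * counting_fun (weight_seq \<omega> l') t \<le> counting_fun (weight_seq \<omega> l) (A * t)"
proof -
  define S where "S = {p. p > 0 \<and> weight_quot \<omega> l' p \<le> t}"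
  have fin: "finite S" unfolding S_def by (intro finite_weight_quot_le assms)
  show ?thesis
  proof (cases "S = {}")
    case True
    then show ?thesis by (simp add: counting_fun_weight_seq flip: S_def)
  next
    case False
    define n where "n = Max S"
    have "n \<in> S" unfolding n_def using fin False by (rule Max_in)
    have "S \<subseteq> {1..n}" using fin by (auto simp: n_def S_def)
    then have "card S \<le> n" using card_mono[of "{1..n}" S] by simp
    have "weight_quot \<omega> l p \<le> A * t" if "p \<in> {1..2 * n}" for p
    proof -
      have "weight_quot \<omega> l p \<le> weight_quot \<omega> l (2 * n)"
        using that assms by (intro weight_quot_mono) auto
      also have "\<dots> \<le> A * weight_quot \<omega> l' n" by (rule quot)
      also have "\<dots> \<le> A * t"
        using \<open>n \<in> S\<close> assms by (intro mult_left_mono) (auto simp: S_def)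
      finally show ?thesis .
    qed
    then have "{1..2 * n} \<subseteq> {p. p > 0 \<and> weight_quot \<omega> l p \<le> A * t}" by auto
    then have "2 * n \<le> card {p. p > 0 \<and> weight_quot \<omega> l p \<le> A * t}"
      using card_mono[OF finite_weight_quot_le[OF assms(1,2)], of "{1..2 * n}" "A * t"] by simp
    with \<open>card S \<le> n\<close> show ?thesis
      by (simp add: counting_fun_weight_seq S_def)
  qed
qed

theorem corollary3p8:
  fixes \<omega> :: "real \<Rightarrow> real"
    and W :: "real \<Rightarrow> nat \<Rightarrow> real"
    and \<theta> :: "real \<Rightarrow> nat \<Rightarrow> real"
  defines "W \<equiv> weight_seq \<omega>"
    and "\<theta> \<equiv> weight_quot \<omega>"
  assumes "\<omega> \<in> \<W>\<^sub>0"
  shows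
    "(\<forall>x>0. \<exists>C>0. \<exists>y>0. \<forall>p q. W x (p + q) \<le> C ^ (p + q) * W y p * W y q)
   \<and> (\<forall>x>0. \<exists>C>0. \<exists>y>0. \<forall>p. W x (2 * p) \<le> C ^ (2 * p) * (W y p)\<^sup>2)
   \<and> (\<forall>x>0. \<exists>H\<ge>1. \<exists>y>0. \<forall>t\<ge>0. 2 * assoc_weight (W y) t \<le> assoc_weight (W x) (H * t) + H)
   \<and> (\<forall>x>0. \<exists>A\<ge>1. \<exists>y>0. \<forall>p. \<theta> x (2 * p) \<le> A * \<theta> y p)
   \<and> (\<forall>x>0. \<exists>A\<ge>1. \<exists>y>0. \<forall>t\<ge>0. 2 * counting_fun (W y) t \<le> counting_fun (W x) (A * t))
   \<and> (\<forall>x>0. \<exists>C>0. \<exists>y>0. \<forall>p q. W y (p + q) \<le> C ^ (p + q) * W x p * W x q)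
   \<and> (\<forall>y>0. \<exists>C>0. \<exists>x>0. \<forall>p. W x (2 * p) \<le> C ^ (2 * p) * (W y p)\<^sup>2)
   \<and> (\<forall>x>0. \<exists>H\<ge>1. \<exists>y>0. \<forall>t\<ge>0. 2 * assoc_weight (W x) t \<le> assoc_weight (W y) (H * t) + H)
   \<and> (\<forall>x>0. \<exists>A\<ge>1. \<exists>y>0. \<forall>p. \<theta> y (2 * p) \<le> A * \<theta> x p)
   \<and> (\<forall>x>0. \<exists>A\<ge>1. \<exists>y>0. \<forall>t\<ge>0. 2 * counting_fun (W x) t \<le> counting_fun (W y) (A * t))"
proof -
  note \<omega> = assms(3)
  \<comment> \<open>The relation between \<open>l\<close> and \<open>y\<close> is kept as an
    equation, so that either index can be the prescribed one.\<close>
  have I: "\<exists>C>0. \<forall>p q. W l (p + q) \<le> C ^ (p + q) * W y p * W y q"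
    if "l > 0" "y = 2 * l" for l y
    using weight_seq_add_le[OF \<omega> that(1)] that(2) by (intro exI[of _ 1]) (simp add: W_def)
  have II: "\<exists>C>0. \<forall>p. W l (2 * p) \<le> C ^ (2 * p) * (W y p)\<^sup>2"
    if "l > 0" "y = 2 * l" for l y
    using I[OF that] by (metis mult_2 power2_eq_square mult.assoc)
  have III: "\<exists>H\<ge>1. \<forall>t\<ge>0. 2 * assoc_weight (W y) t \<le> assoc_weight (W l) (H * t) + H"
    if "l > 0" "y = 2 * l" for l y
  proof (intro exI conjI allI impI)
    fix t :: real
    assume "t \<ge> 0"
    \<comment> \<open>The witness is \<open>H = 1\<close>; the summand 1 is slack.\<close>
    then show "2 * assoc_weight (W y) t \<le> assoc_weight (W l) (1 * t) + 1"
      using double_assoc_weight_le[OF \<omega> that(1), of t] that(2) by (simp add: W_def)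
  qed simp
  have IV: "\<exists>A\<ge>1. \<forall>p. \<theta> l (2 * p) \<le> A * \<theta> y p" if "l > 0" "y = 4 * l" for l y
    using weight_quot_double_le[OF \<omega> that(1)] that(2)
    by (intro exI[of _ "max 1 (weight_quot \<omega> l 2)"]) (simp add: \<theta>_def)
  have V: "\<exists>A\<ge>1. \<forall>t\<ge>0. 2 * counting_fun (W y) t \<le> counting_fun (W l) (A * t)"
    if "l > 0" "y = 4 * l" for l y
  proof -
    from IV[OF that] obtain A
      where "A \<ge> 1" "\<And>p. weight_quot \<omega> l (2 * p) \<le> A * weight_quot \<omega> y p"
      by (auto simp: \<theta>_def)
    then show ?thesis
      using double_counting_fun_le[OF \<omega>, of l y A] that by (intro exI[of _ A]) (auto simp: W_def)
  qed
  have pos: "2 * x > 0" "4 * x > 0" "x / 2 > 0" "x / 4 > 0" if "x > 0" for x :: real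
    using that by auto
  \<comment> \<open>For the Beurling type the prescribed index is the larger one, so the witness is
    \<open>x / 2\<close> or \<open>x / 4\<close>.\<close>
  have mult: "x = 2 * (x / 2)" "x = 4 * (x / 4)" for x :: real
    by auto
  show ?thesis
    apply (intro conjI allI impI)
    subgoal for x using I[OF _ refl, of x] pos(1)[of x] by blast
    subgoal for x using II[OF _ refl, of x] pos(1)[of x] by blast
    subgoal for x using III[OF _ refl, of x] pos(1)[of x] by blast
    subgoal for x using IV[OF _ refl, of x] pos(2)[of x] by blast
    subgoal for x using V[OF _ refl, of x] pos(2)[of x] by blast
    subgoal for x using I[OF pos(3) mult(1), of x] pos(3)[of x] by blast
    subgoal for x using II[OF pos(3) mult(1), of x] pos(3)[of x] by blast
    subgoal for x using III[OF pos(3) mult(1), of x] pos(3)[of x] by blast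
    subgoal for x using IV[OF pos(4) mult(2), of x] pos(4)[of x] by blast
    subgoal for x using V[OF pos(4) mult(2), of x] pos(4)[of x] by blast
    done
qed

end
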